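(* Consider the adjacency-list model augmented with $\texttt{ADJ}$ (and without $\texttt{JUMP}$ and $\texttt{IN-SORTED}$). For any $n$ and $m$ with $n\le m\le n^2$, there exists a directed graph $G=(V,E)$ with $\Theta(n)$ nodes and $\Theta(m)$ edges such that for any algorithm solving the single-node problem, the expected running time on $G$, averaged over all targets $t\in V$, is $\Omega(m)$. In particular, this bound holds for a worst-case target $t\in V$.
   Context: Fix a constant $\alpha\in(0,1)$. For a directed graph $G=(V,E)$ with $n=|V|$, an $\alpha$-discounted random walk from $s$: at each step, with probability $\alpha$ it terminates at the current node, otherwise it moves to a uniformly random out-neighbor of the current node. $\pi(s,t)$ is the probability that such a walk from $s$ terminates at $t$, and $\pi(t)=\frac1n\sum_{s\in V}\pi(s,t)$. Adjacency-list model: an algorithm accesses $G$ only through constant-time queries $\texttt{DEG-IN}(u)$, $\texttt{DEG-OUT}(u)$ (in-/out-degree of $u$), $\texttt{IN}(u,i)$, $\texttt{OUT}(u,i)$ ($i$-th in-/out-neighbor of $u$); additionally $\texttt{ADJ}(u,v)$ returns whether $(u,v)\in E$. Single-node problem: given $G$ (via queries) and a target $t\in V$, output $\hat\pi(t)$ with $\Pr\{|\hat\pi(t)-\pi(t)|\ge\varepsilon\pi(t)\}\le p_f$, where $\varepsilon,p_f$ are fixed small constants; an algorithm solves the problem if this holds for every input. *)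

theory Defs
  imports "HOL-Probability.Probability" "Graph_Theory.Pair_Digraph"
begin

text \<open>
  Inputs are finite directed graphs without parallel edges (self-loops are allowed, so there are
  at most $n^2$ edges). Every node has an out-neighbour, so that a walk can always move on.
\<close>

definition pagerank_graph :: "nat pair_pre_digraph \<Rightarrow> bool" where
  "pagerank_graph G \<longleftrightarrow> pair_fin_digraph G \<and> (\<forall>u\<in>pverts G. parcs G `` {u} \<noteq> {})"


section \<open>PageRank\<close>

datatype walk_state = At nat | Terminated nat

fun walk_step :: "real \<Rightarrow> nat pair_pre_digraph \<Rightarrow> walk_state \<Rightarrow> walk_state pmf" where
  "walk_step \<alpha> G (Terminated v) = return_pmf (Terminated v)"
| "walk_step \<alpha> G (At v) =
     bernoulli_pmf \<alpha> \<bind>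
       (\<lambda>stop. if stop then return_pmf (Terminated v) else map_pmf At (pmf_of_set (parcs G `` {v})))"

primrec walk :: "real \<Rightarrow> nat pair_pre_digraph \<Rightarrow> nat \<Rightarrow> nat \<Rightarrow> walk_state pmf" where
  "walk \<alpha> G s 0 = return_pmf (At s)"
| "walk \<alpha> G s (Suc k) = walk \<alpha> G s k \<bind> walk_step \<alpha> G"

text \<open>
  The events ``terminated at \<open>t\<close> within \<open>k\<close> steps'' increase with \<open>k\<close>; the supremum is the
  probability of their union.
\<close>

definition ppr :: "real \<Rightarrow> nat pair_pre_digraph \<Rightarrow> nat \<Rightarrow> nat \<Rightarrow> real" where
  "ppr \<alpha> G s t = (SUP k. pmf (walk \<alpha> G s k) (Terminated t))"

definition pagerank :: "real \<Rightarrow> nat pair_pre_digraph \<Rightarrow> nat \<Rightarrow> real" where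
  "pagerank \<alpha> G t = (\<Sum>s\<in>pverts G. ppr \<alpha> G s t) / real (card (pverts G))"


section \<open>Adjacency-list model with ADJ\<close>

record adj_lists =
  graph_of :: "nat pair_pre_digraph"
  out_list :: "nat \<Rightarrow> nat list"
  in_list :: "nat \<Rightarrow> nat list"

definition valid_input :: "adj_lists \<Rightarrow> bool" where
  "valid_input X \<longleftrightarrow> pagerank_graph (graph_of X) \<and>
     (\<forall>u\<in>pverts (graph_of X).
        distinct (out_list X u) \<and> set (out_list X u) = {v. (u, v) \<in> parcs (graph_of X)} \<and>
        distinct (in_list X u) \<and> set (in_list X u) = {v. (v, u) \<in> parcs (graph_of X)})"

datatype query = DEG_IN nat | DEG_OUT nat | IN nat nat | OUT nat nat | ADJ nat nat

datatype answer = Degree nat | Neighbor nat | Adjacent bool | Undefined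

fun query_nodes :: "query \<Rightarrow> nat set" where
  "query_nodes (DEG_IN u) = {u}"
| "query_nodes (DEG_OUT u) = {u}"
| "query_nodes (IN u i) = {u}"
| "query_nodes (OUT u i) = {u}"
| "query_nodes (ADJ u v) = {u, v}"

text \<open>Neighbours are numbered from 0.\<close>

fun oracle_answer :: "adj_lists \<Rightarrow> query \<Rightarrow> answer" where
  "oracle_answer X (DEG_IN u) = Degree (length (in_list X u))"
| "oracle_answer X (DEG_OUT u) = Degree (length (out_list X u))"
| "oracle_answer X (IN u i) =
     (if i < length (in_list X u) then Neighbor (in_list X u ! i) else Undefined)"
| "oracle_answer X (OUT u i) =
     (if i < length (out_list X u) then Neighbor (out_list X u ! i) else Undefined)"
| "oracle_answer X (ADJ u v) = Adjacent ((u, v) \<in> parcs (graph_of X))"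

text \<open>
  A transcript records everything that has happened so far: the queries with their answers, and
  the internal steps, each with a value the algorithm has stored (such as random bits it has drawn).
  Because there is no JUMP, an algorithm can only address nodes it has discovered, i.e. the target
  and the nodes returned by earlier IN and OUT queries; any other query yields no information.
\<close>

datatype event = Asked query answer | Computed nat

definition discovered :: "nat \<Rightarrow> event list \<Rightarrow> nat set" where
  "discovered t h = insert t {v. \<exists>q. Asked q (Neighbor v) \<in> set h}"

definition reply :: "adj_lists \<Rightarrow> nat \<Rightarrow> event list \<Rightarrow> query \<Rightarrow> answer" where
  "reply X t h q = (if query_nodes q \<subseteq> discovered t h then oracle_answer X q else Undefined)"

text \<open>
  A randomized algorithm is given the number of nodes and the target. It chooses its next action at
  random, with a distribution that may depend in any way on the transcript. Queries and internal
  steps take one unit of time each.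
\<close>

datatype action = Query query | Compute nat | Output real

type_synonym algorithm = "nat \<Rightarrow> nat \<Rightarrow> event list \<Rightarrow> action pmf"

datatype run_state = Running "event list" | Halted "event list" real

fun transcript :: "run_state \<Rightarrow> event list" where
  "transcript (Running h) = h"
| "transcript (Halted h x) = h"

fun act :: "adj_lists \<Rightarrow> nat \<Rightarrow> event list \<Rightarrow> action \<Rightarrow> run_state" where
  "act X t h (Query q) = Running (h @ [Asked q (reply X t h q)])"
| "act X t h (Compute r) = Running (h @ [Computed r])"
| "act X t h (Output x) = Halted h x"

fun run_step :: "algorithm \<Rightarrow> adj_lists \<Rightarrow> nat \<Rightarrow> run_state \<Rightarrow> run_state pmf" where
  "run_step A X t (Halted h x) = return_pmf (Halted h x)"
| "run_step A X t (Running h) = map_pmf (act X t h) (A (card (pverts (graph_of X))) t h)"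

primrec run :: "algorithm \<Rightarrow> adj_lists \<Rightarrow> nat \<Rightarrow> nat \<Rightarrow> run_state pmf" where
  "run A X t 0 = return_pmf (Running [])"
| "run A X t (Suc k) = run A X t k \<bind> run_step A X t"

text \<open>
  The transcript length is the time elapsed so far. Its expectation after \<open>k\<close> steps increases with
  \<open>k\<close>, and the supremum is the expected running time (infinite if the algorithm fails to halt with
  positive probability).
\<close>

definition expected_time :: "algorithm \<Rightarrow> adj_lists \<Rightarrow> nat \<Rightarrow> ennreal" where
  "expected_time A X t =
     (SUP k. \<integral>\<^sup>+ s. of_nat (length (transcript s)) \<partial>measure_pmf (run A X t k))"

fun accurate :: "real \<Rightarrow> real \<Rightarrow> run_state \<Rightarrow> bool" where
  "accurate \<epsilon> p (Halted h x) \<longleftrightarrow> \<not> \<bar>x - p\<bar> \<ge> \<epsilon> * p"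
| "accurate \<epsilon> p (Running h) \<longleftrightarrow> False"

text \<open>Never halting counts as a failure. The events decrease with \<open>k\<close>.\<close>

definition failure_prob :: "real \<Rightarrow> real \<Rightarrow> algorithm \<Rightarrow> adj_lists \<Rightarrow> nat \<Rightarrow> real" where
  "failure_prob \<alpha> \<epsilon> A X t =
     (INF k. measure_pmf.prob (run A X t k) {s. \<not> accurate \<epsilon> (pagerank \<alpha> (graph_of X) t) s})"

definition solves_single_node :: "real \<Rightarrow> real \<Rightarrow> real \<Rightarrow> algorithm \<Rightarrow> bool" where
  "solves_single_node \<alpha> \<epsilon> p\<^sub>f A \<longleftrightarrow>
     (\<forall>X t. valid_input X \<longrightarrow> t \<in> pverts (graph_of X) \<longrightarrow> failure_prob \<alpha> \<epsilon> A X t \<le> p\<^sub>f)"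

end

theory Submission
  imports Defs
begin

text \<open>
  The hard graph has two mutually unreachable parts: a visible graph \<open>H\<close>, consisting of complete
  bipartite layers \<open>U \<rightarrow> W \<rightarrow> T\<close> with \<open>|U| = |T| = n\<close> and \<open>|W| = m div n\<close> and self-loops on \<open>T\<close>, and a
  reservoir \<open>S \<union> {hub}\<close> of \<open>\<Theta>(n)\<close> nodes carrying only self-loops, which an algorithm started in \<open>H\<close>
  cannot discover. For each of the \<open>\<Theta>(m)\<close> arcs \<open>(u, w)\<close> from \<open>U\<close> to \<open>W\<close> there is a planted variant in
  which all of \<open>S\<close> points to \<open>hub\<close>, and \<open>u \<rightarrow> w\<close> is replaced by \<open>u \<rightarrow> hub \<rightarrow> w\<close>. The reservoir then
  feeds every target in \<open>T\<close> through \<open>w\<close>, which raises its PageRank by a factor of at least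
  \<open>(1 + \<epsilon>) / (1 - \<epsilon>)\<close>, so a correct algorithm has to tell the variants from the original. All degrees
  in \<open>H\<close> are preserved, and only queries that probe the very arc \<open>(u, w)\<close> are answered differently;
  until such a query is made, the runs on the two inputs can be coupled to be identical. As a query
  probes at most one arc and every arc must be probed with probability at least a constant, the
  expected number of queries is \<open>\<Omega>(m)\<close>.
\<close>

section \<open>Preliminaries\<close>

lemma Id_on_eq_image: "Id_on A = (\<lambda>v. (v, v)) ` A"
  by auto

lemma finite_Id_on: "finite A \<Longrightarrow> finite (Id_on A)"
  by (simp add: Id_on_eq_image)

lemma card_Id_on: "card (Id_on A) = card A"
  unfolding Id_on_eq_image by (rule card_image) (simp add: inj_on_def)

lemma card_disjoint_family_meeting_le:
  assumes "disjoint_family_on B I" "finite Q"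
  shows "card {i\<in>I. Q \<inter> B i \<noteq> {}} \<le> card Q"
proof -
  let ?J = "{i\<in>I. Q \<inter> B i \<noteq> {}}"
  have "\<forall>i\<in>?J. \<exists>q. q \<in> Q \<inter> B i"
    by blast
  then obtain f where f: "\<forall>i\<in>?J. f i \<in> Q \<inter> B i"
    by (rule bchoice[THEN exE])
  have "inj_on f ?J"
  proof (rule inj_onI)
    fix i j assume ij: "i \<in> ?J" "j \<in> ?J" "f i = f j"
    then have "f i \<in> B i \<inter> B j"
      using bspec[OF f ij(1)] bspec[OF f ij(2)] by simp
    then show "i = j"
      using disjoint_family_onD[OF assms(1), of i j] ij by blast
  qed
  then show ?thesis
    using f assms(2) by (intro card_inj_on_le[of f]) auto
qed

lemma mean_ge_if_ge_on_subset:
  fixes f :: "'a \<Rightarrow> ennreal"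
  assumes V: "finite V" "V \<noteq> {}" and T: "T \<subseteq> V" "real (card V) \<le> C * real (card T)"
    and f_ge: "\<And>t. t \<in> T \<Longrightarrow> ennreal a \<le> f t" and "0 \<le> a"
  shows "ennreal (a / C) \<le> sum f V / of_nat (card V)"
proof -
  have card: "real (card V) > 0"
    using V by (simp add: card_gt_0_iff)
  then have "0 < C * real (card T)"
    using T(2) by linarith
  then have C: "0 < C"
    by (simp add: zero_less_mult_iff)
  have "a / C * real (card V) \<le> a / C * (C * real (card T))"
    using T(2) \<open>0 \<le> a\<close> C by (intro mult_left_mono) auto
  then have "ennreal (a / C * real (card V)) \<le> (\<Sum>t\<in>T. ennreal a)"
    using \<open>0 \<le> a\<close> C
    by (simp add: ennreal_leI ennreal_mult'[symmetric] ennreal_of_nat_eq_real_of_nat mult.commute)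
  also have "\<dots> \<le> sum f T"
    using f_ge by (rule sum_mono)
  also have "\<dots> \<le> sum f V"
    using V T by (intro sum_mono2) auto
  finally have "ennreal (a / C * real (card V)) / of_nat (card V) \<le> sum f V / of_nat (card V)"
    by (rule divide_right_mono_ennreal)
  then show ?thesis
    using card \<open>0 \<le> a\<close> C by (simp add: ennreal_of_nat_eq_real_of_nat divide_ennreal)
qed

lemma ex_ge_mean:
  fixes f :: "'a \<Rightarrow> ennreal"
  assumes "finite V" "V \<noteq> {}"
  shows "\<exists>t\<in>V. sum f V / of_nat (card V) \<le> f t"
proof -
  obtain t where t: "t \<in> V" "Max (f ` V) = f t"
    using obtains_MAX[OF assms, of f] by metis
  have "sum f V / of_nat (card V) \<le> of_nat (card V) * f t / of_nat (card V)"
    using assms(1) t(2)[symmetric] by (intro divide_right_mono_ennreal sum_bounded_above) simp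
  also have "\<dots> = f t"
    using assms by (simp add: mult.commute[of "of_nat (card V)"] ennreal_mult_divide_eq)
  finally show ?thesis
    using t(1) by blast
qed

lemma pmf_bind_ge: "pmf M x * pmf (f x) y \<le> pmf (M \<bind> f) y"
proof -
  have "ennreal (pmf M x * pmf (f x) y) =
      (\<integral>\<^sup>+ z. ennreal (pmf (f x) y) * indicator {x} z \<partial>measure_pmf M)"
    by (simp add: nn_integral_cmult_indicator emeasure_pmf_single ennreal_mult mult.commute)
  also have "\<dots> \<le> (\<integral>\<^sup>+ z. ennreal (pmf (f z) y) \<partial>measure_pmf M)"
    by (intro nn_integral_mono) (auto simp: indicator_def)
  also have "\<dots> = ennreal (pmf (M \<bind> f) y)"
    by (simp add: ennreal_pmf_bind)
  finally show ?thesis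
    by simp
qed


section \<open>Markov chains\<close>

primrec chain :: "('a \<Rightarrow> 'a pmf) \<Rightarrow> 'a \<Rightarrow> nat \<Rightarrow> 'a pmf" where
  "chain K x 0 = return_pmf x"
| "chain K x (Suc k) = chain K x k \<bind> K"

lemma walk_eq_chain: "walk \<alpha> G s k = chain (walk_step \<alpha> G) (At s) k"
  by (induction k) simp_all

lemma run_eq_chain: "run A X t k = chain (run_step A X t) (Running []) k"
  by (induction k) simp_all

lemma set_pmf_chain_subset:
  assumes "x \<in> I" "\<And>y. y \<in> I \<Longrightarrow> set_pmf (K y) \<subseteq> I"
  shows "set_pmf (chain K x k) \<subseteq> I"
  using assms by (induction k) auto

lemma decseq_nn_integral_chain:
  assumes "x \<in> I" "\<And>y. y \<in> I \<Longrightarrow> set_pmf (K y) \<subseteq> I"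
    and super: "\<And>y. y \<in> I \<Longrightarrow> (\<integral>\<^sup>+ z. F z \<partial>measure_pmf (K y)) \<le> F y"
  shows "decseq (\<lambda>k. \<integral>\<^sup>+ y. F y \<partial>measure_pmf (chain K x k))"
proof (rule decseq_SucI)
  fix k
  have "set_pmf (chain K x k) \<subseteq> I"
    using assms(1,2) by (rule set_pmf_chain_subset)
  then have "AE y in measure_pmf (chain K x k). (\<integral>\<^sup>+ z. F z \<partial>measure_pmf (K y)) \<le> F y"
    unfolding AE_measure_pmf_iff using super by blast
  then show "(\<integral>\<^sup>+ y. F y \<partial>measure_pmf (chain K x (Suc k)))
      \<le> (\<integral>\<^sup>+ y. F y \<partial>measure_pmf (chain K x k))"
    by (simp add: nn_integral_mono_AE)
qed

lemma decseq_prob_chain_not_absorbed: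
  assumes absorbing: "\<And>y. y \<in> E \<Longrightarrow> set_pmf (K y) \<subseteq> E"
  shows "decseq (\<lambda>k. measure_pmf.prob (chain K x k) (- E))"
proof -
  have "emeasure (measure_pmf (K y)) (- E) \<le> indicator (- E) y" for y
  proof (cases "y \<in> E")
    case True
    then have "- E \<inter> set_pmf (K y) = {}"
      using absorbing by blast
    then have "emeasure (measure_pmf (K y)) (- E) = 0"
      by (metis emeasure_Int_set_pmf emeasure_empty)
    then show ?thesis
      by simp
  qed (simp add: measure_pmf.emeasure_le_1)
  then have "decseq (\<lambda>k. \<integral>\<^sup>+ y. indicator (- E) y \<partial>measure_pmf (chain K x k))"
    by (intro decseq_nn_integral_chain[where I = UNIV]) auto
  then show ?thesis
    by (simp add: measure_pmf.emeasure_eq_measure decseq_def)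
qed

lemma rel_pmf_chain:
  assumes "R x y" "\<And>x y. R x y \<Longrightarrow> rel_pmf R (K x) (L y)"
  shows "rel_pmf R (chain K x k) (chain L y k)"
  using assms by (induction k) (auto intro: rel_pmf_bindI)


section \<open>Bounds on personalized PageRank\<close>

abbreviation outdeg :: "nat pair_pre_digraph \<Rightarrow> nat \<Rightarrow> nat" where
  "outdeg G v \<equiv> card (parcs G `` {v})"

definition out_mean :: "nat pair_pre_digraph \<Rightarrow> (nat \<Rightarrow> real) \<Rightarrow> nat \<Rightarrow> real" where
  "out_mean G f v = (\<Sum>z\<in>parcs G `` {v}. f z) / real (outdeg G v)"

lemma pagerank_graph_out_nbrs:
  assumes "pagerank_graph G"
  shows "finite (parcs G `` {v})" "parcs G `` {v} \<subseteq> pverts G"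
    and "v \<in> pverts G \<Longrightarrow> parcs G `` {v} \<noteq> {}"
proof -
  interpret pair_fin_digraph G
    using assms by (simp add: pagerank_graph_def)
  show "finite (parcs G `` {v})"
    using pair_finite_arcs by (rule finite_Image)
  show "parcs G `` {v} \<subseteq> pverts G"
    using in_arcsD2 by auto
  show "parcs G `` {v} \<noteq> {}" if "v \<in> pverts G"
    using assms that by (auto simp: pagerank_graph_def)
qed

lemma pmf_le_ppr: "pmf (walk \<alpha> G s k) (Terminated t) \<le> ppr \<alpha> G s t"
  unfolding ppr_def by (rule cSUP_upper) (auto intro!: bdd_aboveI[of _ 1] simp: pmf_le_1)

lemma ppr_nonneg: "0 \<le> ppr \<alpha> G s t"
  by (rule order_trans[OF pmf_nonneg pmf_le_ppr])

lemma pmf_walk_step_At: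
  assumes "0 \<le> \<alpha>" "\<alpha> \<le> 1" "finite (parcs G `` {v})" "(v, z) \<in> parcs G"
  shows "pmf (walk_step \<alpha> G (At v)) (At z) = (1 - \<alpha>) / real (outdeg G v)"
proof -
  have "z \<in> parcs G `` {v}"
    using assms by auto
  then have "pmf (map_pmf At (pmf_of_set (parcs G `` {v}))) (At z) = 1 / real (outdeg G v)"
    using assms(3) by (subst pmf_map_inj', simp add: inj_def, subst pmf_of_set) auto
  then show ?thesis
    using assms(1,2) by (simp add: pmf_bind)
qed

lemma pmf_walk_step_Terminated:
  assumes "0 \<le> \<alpha>" "\<alpha> \<le> 1"
  shows "pmf (walk_step \<alpha> G (At v)) (Terminated v) = \<alpha>"
proof -
  have "pmf (map_pmf At M) (Terminated v) = 0" for M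
    by (auto simp: pmf_eq_0_set_pmf)
  then show ?thesis
    using assms by (simp add: pmf_bind)
qed

lemma pmf_walk_path_ge:
  assumes "0 \<le> \<alpha>" "\<alpha> \<le> 1" "finite (parcs G)"
    and "successively (\<lambda>u v. (u, v) \<in> parcs G) (vs @ [t])"
  shows "(\<Prod>v\<leftarrow>vs. (1 - \<alpha>) / real (outdeg G v)) \<le> pmf (walk \<alpha> G (hd (vs @ [t])) (length vs)) (At t)"
  using assms(4)
proof (induction vs arbitrary: t rule: rev_induct)
  case (snoc v vs)
  have arc: "(v, t) \<in> parcs G" and path: "successively (\<lambda>u v. (u, v) \<in> parcs G) (vs @ [v])"
    using snoc.prems by (auto simp: successively_append_iff)
  let ?W = "walk \<alpha> G (hd (vs @ [v])) (length vs)"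
  have "(\<Prod>v\<leftarrow>vs. (1 - \<alpha>) / real (outdeg G v)) * ((1 - \<alpha>) / real (outdeg G v))
      \<le> pmf ?W (At v) * pmf (walk_step \<alpha> G (At v)) (At t)"
    unfolding pmf_walk_step_At[OF assms(1,2) finite_Image[OF assms(3)] arc]
    using snoc.IH[OF path] assms(2) by (intro mult_right_mono) auto
  also have "\<dots> \<le> pmf (?W \<bind> walk_step \<alpha> G) (At t)"
    by (rule pmf_bind_ge)
  also have "hd (vs @ [v]) = hd ((vs @ [v]) @ [t])"
    by (cases vs) simp_all
  finally show ?case
    by simp
qed simp

lemma ppr_path_ge:
  assumes \<alpha>: "0 \<le> \<alpha>" "\<alpha> \<le> 1" and "finite (parcs G)"
    and "successively (\<lambda>u v. (u, v) \<in> parcs G) (vs @ [t])"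
  shows "(\<Prod>v\<leftarrow>vs. (1 - \<alpha>) / real (outdeg G v)) * \<alpha> \<le> ppr \<alpha> G (hd (vs @ [t])) t"
proof -
  let ?W = "walk \<alpha> G (hd (vs @ [t])) (length vs)"
  have "(\<Prod>v\<leftarrow>vs. (1 - \<alpha>) / real (outdeg G v)) * \<alpha>
      \<le> pmf ?W (At t) * pmf (walk_step \<alpha> G (At t)) (Terminated t)"
    unfolding pmf_walk_step_Terminated[OF \<alpha>]
    using pmf_walk_path_ge[OF assms] \<alpha>(1) by (rule mult_right_mono)
  also have "\<dots> \<le> pmf (walk \<alpha> G (hd (vs @ [t])) (Suc (length vs))) (Terminated t)"
    unfolding walk.simps(2) by (rule pmf_bind_ge)
  also have "\<dots> \<le> ppr \<alpha> G (hd (vs @ [t])) t"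
    by (rule pmf_le_ppr)
  finally show ?thesis .
qed

definition ppr_supersolution :: "real \<Rightarrow> nat pair_pre_digraph \<Rightarrow> nat \<Rightarrow> (nat \<Rightarrow> real) \<Rightarrow> bool" where
  "ppr_supersolution \<alpha> G t f \<longleftrightarrow>
     (\<forall>v. 0 \<le> f v) \<and> (\<forall>v\<in>pverts G. \<alpha> * of_bool (v = t) + (1 - \<alpha>) * out_mean G f v \<le> f v)"

primrec payoff :: "nat \<Rightarrow> (nat \<Rightarrow> real) \<Rightarrow> walk_state \<Rightarrow> real" where
  "payoff t f (At v) = f v"
| "payoff t f (Terminated v) = of_bool (v = t)"

lemma nn_integral_payoff_walk_step_At:
  assumes "0 \<le> \<alpha>" "\<alpha> \<le> 1" "finite (parcs G `` {v})" "parcs G `` {v} \<noteq> {}" "\<And>v. 0 \<le> f v"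
  shows "(\<integral>\<^sup>+ y. ennreal (payoff t f y) \<partial>measure_pmf (walk_step \<alpha> G (At v))) =
    ennreal (\<alpha> * of_bool (v = t) + (1 - \<alpha>) * out_mean G f v)"
  using assms
  by (simp add: out_mean_def nn_integral_pmf_of_set ennreal_plus ennreal_mult sum_nonneg card_gt_0_iff
      divide_ennreal[symmetric] ennreal_of_nat_eq_real_of_nat ennreal_times_divide mult.commute)

lemma nn_integral_payoff_walk_le:
  assumes G: "pagerank_graph G" and s: "s \<in> pverts G" and \<alpha>: "0 \<le> \<alpha>" "\<alpha> \<le> 1"
    and f: "ppr_supersolution \<alpha> G t f"
  shows "(\<integral>\<^sup>+ y. ennreal (payoff t f y) \<partial>measure_pmf (walk \<alpha> G s k)) \<le> ennreal (f s)"
proof -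
  define I where "I = At ` pverts G \<union> range Terminated"
  note out_nbrs = pagerank_graph_out_nbrs[OF G]
  have invariant: "set_pmf (walk_step \<alpha> G y) \<subseteq> I" if "y \<in> I" for y
    using that out_nbrs by (cases y) (fastforce simp: I_def split: if_splits)+
  have "(\<integral>\<^sup>+ z. ennreal (payoff t f z) \<partial>measure_pmf (walk_step \<alpha> G y)) \<le> ennreal (payoff t f y)"
    if "y \<in> I" for y
  proof (cases y)
    case (At v)
    then have "v \<in> pverts G"
      using that by (auto simp: I_def)
    then show ?thesis
      using f nn_integral_payoff_walk_step_At[OF \<alpha> out_nbrs(1,3)]
      unfolding At ppr_supersolution_def by (simp add: ennreal_leI)
  qed simp
  then have "decseq (\<lambda>k. \<integral>\<^sup>+ y. ennreal (payoff t f y) \<partial>measure_pmf (walk \<alpha> G s k))"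
    unfolding walk_eq_chain using s invariant
    by (intro decseq_nn_integral_chain[where I = I]) (auto simp: I_def)
  then show ?thesis
    by (auto dest: decseqD[of _ 0 k])
qed

lemma ppr_le_supersolution:
  assumes "pagerank_graph G" "s \<in> pverts G" "0 \<le> \<alpha>" "\<alpha> \<le> 1" and f: "ppr_supersolution \<alpha> G t f"
  shows "ppr \<alpha> G s t \<le> f s"
  unfolding ppr_def
proof (rule cSUP_least)
  fix k
  have f_nonneg: "0 \<le> f v" for v
    using f by (simp add: ppr_supersolution_def)
  then have "indicator {Terminated t} y \<le> ennreal (payoff t f y)" for y
    by (cases y) auto
  then have "(\<integral>\<^sup>+ y. indicator {Terminated t} y \<partial>measure_pmf (walk \<alpha> G s k))
      \<le> (\<integral>\<^sup>+ y. ennreal (payoff t f y) \<partial>measure_pmf (walk \<alpha> G s k))"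
    by (intro nn_integral_mono)
  also have "\<dots> \<le> ennreal (f s)"
    using assms by (rule nn_integral_payoff_walk_le)
  finally show "pmf (walk \<alpha> G s k) (Terminated t) \<le> f s"
    using f_nonneg by (simp add: emeasure_pmf_single)
qed simp


section \<open>Lower bounds from inputs that differ on few queries\<close>

definition queries :: "event list \<Rightarrow> query set" where
  "queries h = {q. \<exists>a. Asked q a \<in> set h}"

definition asking :: "query set \<Rightarrow> run_state set" where
  "asking B = {s. queries (transcript s) \<inter> B \<noteq> {}}"

lemma queries_snoc_Asked: "queries (h @ [Asked q a]) = insert q (queries h)"
  by (auto simp: queries_def)

lemma queries_snoc_Computed: "queries (h @ [Computed r]) = queries h"
  by (auto simp: queries_def)

lemma finite_queries: "finite (queries h)"
  and card_queries_le_length: "card (queries h) \<le> length h"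
proof -
  define f where "f e = (case e of Asked q a \<Rightarrow> q | Computed r \<Rightarrow> undefined)" for e
  have sub: "queries h \<subseteq> f ` set h"
    by (force simp: queries_def f_def)
  then show "finite (queries h)"
    by (rule finite_subset) simp
  have "card (queries h) \<le> card (f ` set h)"
    using sub by (intro card_mono) auto
  also have "\<dots> \<le> length h"
    using card_image_le[of "set h" f] card_length[of h] by simp
  finally show "card (queries h) \<le> length h" .
qed

lemma discovered_snoc_Asked:
  "discovered t (h @ [Asked q a]) = discovered t h \<union> {v. a = Neighbor v}"
  by (auto simp: discovered_def)

lemma discovered_snoc_Computed: "discovered t (h @ [Computed r]) = discovered t h"
  by (auto simp: discovered_def)

lemma set_pmf_run_step_asking:
  assumes "s \<in> asking B"
  shows "set_pmf (run_step A X t s) \<subseteq> asking B"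
proof (cases s)
  case (Running h)
  have "act X t h a \<in> asking B" for a
    using assms Running by (cases a) (auto simp: asking_def queries_snoc_Asked queries_snoc_Computed)
  then show ?thesis
    using Running by auto
qed (use assms in simp)

definition query_closed :: "adj_lists \<Rightarrow> nat set \<Rightarrow> bool" where
  "query_closed X V \<longleftrightarrow>
     (\<forall>q v. query_nodes q \<subseteq> V \<longrightarrow> oracle_answer X q = Neighbor v \<longrightarrow> v \<in> V)"

definition agree_outside :: "query set \<Rightarrow> nat set \<Rightarrow> adj_lists \<Rightarrow> adj_lists \<Rightarrow> bool" where
  "agree_outside B V X Y \<longleftrightarrow> card (pverts (graph_of X)) = card (pverts (graph_of Y)) \<and>
     (\<forall>q. query_nodes q \<subseteq> V \<longrightarrow> q \<notin> B \<longrightarrow> oracle_answer X q = oracle_answer Y q)"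

definition identical_until :: "query set \<Rightarrow> nat set \<Rightarrow> nat \<Rightarrow> run_state \<Rightarrow> run_state \<Rightarrow> bool" where
  "identical_until B V t s s' \<longleftrightarrow>
     s = s' \<and> discovered t (transcript s) \<subseteq> V \<or> s \<in> asking B \<and> s' \<in> asking B"

lemma identical_until_act:
  assumes "query_closed X V" "agree_outside B V X Y" and h: "discovered t h \<subseteq> V"
  shows "identical_until B V t (act X t h a) (act Y t h a)"
proof (cases a)
  case (Query q)
  show ?thesis
  proof (cases "q \<in> B")
    case True
    then show ?thesis
      using Query by (simp add: identical_until_def asking_def queries_snoc_Asked)
  next
    case False
    have "query_nodes q \<subseteq> V" if "query_nodes q \<subseteq> discovered t h"
      using that h by blast
    then have "reply X t h q = reply Y t h q" "\<And>v. reply X t h q = Neighbor v \<Longrightarrow> v \<in> V"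
      using assms(1,2) False
      by (auto simp: reply_def agree_outside_def query_closed_def
          simp del: query_nodes.simps split: if_splits)
    then show ?thesis
      using Query h by (auto simp: identical_until_def discovered_snoc_Asked)
  qed
qed (use h in \<open>auto simp: identical_until_def discovered_snoc_Computed\<close>)

lemma rel_pmf_run_step:
  assumes "query_closed X V" "agree_outside B V X Y" and "identical_until B V t s s'"
  shows "rel_pmf (identical_until B V t) (run_step A X t s) (run_step A Y t s')"
proof -
  consider (asked) "s \<in> asking B" "s' \<in> asking B"
    | (identical) "s' = s" "discovered t (transcript s) \<subseteq> V"
    using assms(3) by (auto simp: identical_until_def)
  then show ?thesis
  proof cases
    case asked
    then have "identical_until B V t r r'"
      if "r \<in> set_pmf (run_step A X t s)" "r' \<in> set_pmf (run_step A Y t s')" for r r'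
      unfolding identical_until_def using that asked[THEN set_pmf_run_step_asking] by blast
    then show ?thesis
      by (intro rel_pmf.intros[where pq = "pair_pmf (run_step A X t s) (run_step A Y t s')"])
        (auto simp: map_fst_pair_pmf map_snd_pair_pmf)
  next
    case identical
    have same_size: "card (pverts (graph_of X)) = card (pverts (graph_of Y))"
      using assms(2) by (simp add: agree_outside_def)
    show ?thesis
    proof (cases s)
      case (Running h)
      then show ?thesis
        using identical same_size identical_until_act[OF assms(1,2)]
        by (auto simp: pmf.rel_map intro: rel_pmf_reflI)
    qed (use assms(3) identical in simp)
  qed
qed

lemma prob_run_le:
  assumes "t \<in> V" "query_closed X V" "agree_outside B V X Y"
  shows "measure_pmf.prob (run A Y t k) E
    \<le> measure_pmf.prob (run A X t k) E + measure_pmf.prob (run A X t k) (asking B)"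
proof -
  let ?R = "identical_until B V t"
  have "rel_pmf ?R (run A X t k) (run A Y t k)"
    unfolding run_eq_chain using assms
    by (intro rel_pmf_chain rel_pmf_run_step) (auto simp: identical_until_def discovered_def)
  then have "rel_pmf ?R\<inverse>\<inverse> (run A Y t k) (run A X t k)"
    by (simp add: pmf.rel_flip)
  then have "measure_pmf.prob (run A Y t k) E
      \<le> measure_pmf.prob (run A X t k) {s. \<exists>s'\<in>E. ?R\<inverse>\<inverse> s' s}"
    by (rule rel_pmf_measureD)
  also have "\<dots> \<le> measure_pmf.prob (run A X t k) (E \<union> asking B)"
    by (intro measure_pmf.finite_measure_mono) (auto simp: identical_until_def)
  also have "\<dots> \<le> measure_pmf.prob (run A X t k) E + measure_pmf.prob (run A X t k) (asking B)"
    by (rule measure_Un_le) auto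
  finally show ?thesis .
qed

lemma prob_inaccurate_tendsto_failure_prob:
  "(\<lambda>k. measure_pmf.prob (run A X t k) {s. \<not> accurate \<epsilon> (pagerank \<alpha> (graph_of X) t) s})
    \<longlonglongrightarrow> failure_prob \<alpha> \<epsilon> A X t"
  unfolding failure_prob_def
proof (rule LIMSEQ_decseq_INF)
  let ?E = "{s. accurate \<epsilon> (pagerank \<alpha> (graph_of X) t) s}"
  have "set_pmf (run_step A X t s) \<subseteq> ?E" if "s \<in> ?E" for s
    using that by (cases s) auto
  then have "decseq (\<lambda>k. measure_pmf.prob (run A X t k) (- ?E))"
    unfolding run_eq_chain by (rule decseq_prob_chain_not_absorbed)
  then show "decseq (\<lambda>k. measure_pmf.prob (run A X t k)
      {s. \<not> accurate \<epsilon> (pagerank \<alpha> (graph_of X) t) s})"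
    by (simp add: Collect_neg_eq)
qed (auto intro: bdd_belowI[of _ 0])

lemma not_accurate_if_gap:
  assumes "(1 + \<epsilon>) * p \<le> (1 - \<epsilon>) * p'" "accurate \<epsilon> p' s"
  shows "\<not> accurate \<epsilon> p s"
  using assms by (cases s) (auto simp: abs_if algebra_simps split: if_splits)

lemma eventually_prob_asking_ge:
  assumes "t \<in> V" "query_closed X V" "agree_outside B V X Y"
    and fail: "failure_prob \<alpha> \<epsilon> A X t \<le> p\<^sub>f" "failure_prob \<alpha> \<epsilon> A Y t \<le> p\<^sub>f"
    and gap: "(1 + \<epsilon>) * pagerank \<alpha> (graph_of X) t \<le> (1 - \<epsilon>) * pagerank \<alpha> (graph_of Y) t"
    and \<delta>: "\<delta> < 1 - 2 * p\<^sub>f"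
  shows "\<forall>\<^sub>F k in sequentially. \<delta> \<le> measure_pmf.prob (run A X t k) (asking B)"
proof -
  let ?acc = "\<lambda>Z s. accurate \<epsilon> (pagerank \<alpha> (graph_of Z) t) s"
  let ?P = "\<lambda>Z k. measure_pmf.prob (run A Z t k)"
  have "(\<lambda>k. ?P X k {s. \<not> ?acc X s} + ?P Y k {s. \<not> ?acc Y s})
      \<longlonglongrightarrow> failure_prob \<alpha> \<epsilon> A X t + failure_prob \<alpha> \<epsilon> A Y t"
    by (intro tendsto_add prob_inaccurate_tendsto_failure_prob)
  then have "\<forall>\<^sub>F k in sequentially. ?P X k {s. \<not> ?acc X s} + ?P Y k {s. \<not> ?acc Y s} < 1 - \<delta>"
    using fail \<delta> by (intro order_tendstoD(2)) auto
  then show ?thesis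
  proof eventually_elim
    case (elim k)
    have "1 - ?P Y k {s. \<not> ?acc Y s} = ?P Y k {s. ?acc Y s}"
      using measure_pmf.prob_neg[of "run A Y t k" "?acc Y"] by simp
    also have "\<dots> \<le> ?P X k {s. ?acc Y s} + ?P X k (asking B)"
      using assms(1-3) by (rule prob_run_le)
    also have "?P X k {s. ?acc Y s} \<le> ?P X k {s. \<not> ?acc X s}"
      using not_accurate_if_gap[OF gap] by (intro measure_pmf.finite_measure_mono) auto
    finally show ?case
      using elim by linarith
  qed
qed

lemma sum_prob_asking_le_expected_time:
  assumes "disjoint_family_on B I" "finite I"
  shows "ennreal (\<Sum>i\<in>I. measure_pmf.prob (run A X t k) (asking (B i))) \<le> expected_time A X t"
proof -
  have "ennreal (\<Sum>i\<in>I. measure_pmf.prob (run A X t k) (asking (B i))) =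
      (\<integral>\<^sup>+ s. (\<Sum>i\<in>I. indicator (asking (B i)) s) \<partial>measure_pmf (run A X t k))"
    by (subst nn_integral_sum) (auto simp: measure_pmf.emeasure_eq_measure)
  also have "\<dots> \<le> (\<integral>\<^sup>+ s. of_nat (length (transcript s)) \<partial>measure_pmf (run A X t k))"
  proof (rule nn_integral_mono)
    fix s
    have "(\<Sum>i\<in>I. indicator (asking (B i)) s :: ennreal) = of_nat (card {i\<in>I. s \<in> asking (B i)})"
      using \<open>finite I\<close> by (simp add: indicator_def sum.If_cases Int_def)
    also have "card {i\<in>I. s \<in> asking (B i)} \<le> length (transcript s)"
      using card_disjoint_family_meeting_le[OF assms(1) finite_queries] card_queries_le_length
      by (auto simp: asking_def intro: order_trans)
    finally show "(\<Sum>i\<in>I. indicator (asking (B i)) s :: ennreal) \<le> of_nat (length (transcript s))"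
      by simp
  qed
  also have "\<dots> \<le> expected_time A X t"
    unfolding expected_time_def by (rule SUP_upper) simp
  finally show ?thesis .
qed

lemma expected_time_ge_adversary:
  assumes solves: "solves_single_node \<alpha> \<epsilon> p\<^sub>f A" and \<delta>: "\<delta> < 1 - 2 * p\<^sub>f"
    and input: "valid_input X" "t \<in> pverts (graph_of X)"
    and closed: "t \<in> V" "query_closed X V"
    and disjoint: "disjoint_family_on B I" "finite I"
    and variants: "\<And>i. i \<in> I \<Longrightarrow> valid_input (Y i)" "\<And>i. i \<in> I \<Longrightarrow> t \<in> pverts (graph_of (Y i))"
    and agree: "\<And>i. i \<in> I \<Longrightarrow> agree_outside (B i) V X (Y i)"
    and gap: "\<And>i. i \<in> I \<Longrightarrow>
      (1 + \<epsilon>) * pagerank \<alpha> (graph_of X) t \<le> (1 - \<epsilon>) * pagerank \<alpha> (graph_of (Y i)) t"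
  shows "ennreal (\<delta> * real (card I)) \<le> expected_time A X t"
proof -
  let ?P = "\<lambda>k i. measure_pmf.prob (run A X t k) (asking (B i))"
  have "\<forall>\<^sub>F k in sequentially. \<delta> \<le> ?P k i" if "i \<in> I" for i
    using solves input variants[OF that] closed agree[OF that] gap[OF that] \<delta>
    by (intro eventually_prob_asking_ge) (auto simp: solves_single_node_def)
  then have "\<forall>\<^sub>F k in sequentially. \<forall>i\<in>I. \<delta> \<le> ?P k i"
    using disjoint(2) by (intro eventually_ball_finite) auto
  then obtain k where "\<And>i. i \<in> I \<Longrightarrow> \<delta> \<le> ?P k i"
    using eventually_happens'[OF sequentially_bot] by blast
  then have "ennreal (\<delta> * real (card I)) \<le> ennreal (\<Sum>i\<in>I. ?P k i)"
    using sum_bounded_below[of I \<delta> "?P k"] by (intro ennreal_leI) (simp add: mult.commute)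
  also have "\<dots> \<le> expected_time A X t"
    using disjoint by (rule sum_prob_asking_le_expected_time)
  finally show ?thesis .
qed


section \<open>Planted arcs\<close>

text \<open>
  Degree queries probe nothing because planting an arc preserves the degrees in \<open>H\<close>. An index beyond
  the end of a list yields a junk arc, which only makes more queries count as probing that arc.
\<close>

fun probe :: "adj_lists \<Rightarrow> query \<Rightarrow> (nat \<times> nat) option" where
  "probe X (DEG_IN u) = None"
| "probe X (DEG_OUT u) = None"
| "probe X (IN u i) = Some (in_list X u ! i, u)"
| "probe X (OUT u i) = Some (u, out_list X u ! i)"
| "probe X (ADJ u v) = Some (u, v)"

locale reservoir =
  fixes H :: "nat pair_pre_digraph" and S :: "nat set" and hub :: nat
  assumes pagerank_graph_H: "pagerank_graph H"
    and finite_S: "finite S" and hub_notin_S: "hub \<notin> S"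
    and disjoint_H: "pverts H \<inter> insert hub S = {}"
begin

interpretation H: pair_fin_digraph H
  using pagerank_graph_H by (simp add: pagerank_graph_def)

definition base :: "nat pair_pre_digraph" where
  "base = \<lparr>pverts = pverts H \<union> insert hub S, parcs = parcs H \<union> Id_on (insert hub S)\<rparr>"

definition planted :: "nat \<Rightarrow> nat \<Rightarrow> nat pair_pre_digraph" where
  "planted u w = \<lparr>pverts = pverts H \<union> insert hub S,
     parcs = parcs H - {(u, w)} \<union> {(u, hub), (hub, w)} \<union> S \<times> {hub}\<rparr>"

definition redirect :: "nat \<Rightarrow> nat \<Rightarrow> nat \<Rightarrow> nat \<Rightarrow> nat" where
  "redirect a b v = (if v = a then id(b := hub) else id)"

lemma reservoir_notin_H: "hub \<notin> pverts H" "s \<in> S \<Longrightarrow> s \<notin> pverts H"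
  using disjoint_H by auto

lemma pverts_planted: "pverts (planted u w) = pverts base"
  by (simp add: planted_def base_def)

lemma pverts_H_subset_base: "pverts H \<subseteq> pverts base"
  by (auto simp: base_def)

lemma finite_pverts_base: "finite (pverts base)"
  by (simp add: base_def finite_S)

lemma card_pverts_base: "card (pverts base) = card (pverts H) + card S + 1"
  using finite_S hub_notin_S disjoint_H by (simp add: base_def card_Un_disjoint del: Un_insert_right)

lemma card_parcs_base: "card (parcs base) = card (parcs H) + card S + 1"
proof -
  have "parcs H \<inter> Id_on (insert hub S) = {}"
    using H.in_arcsD1 reservoir_notin_H by blast
  then show ?thesis
    using finite_S hub_notin_S by (simp add: base_def card_Un_disjoint card_Id_on finite_Id_on)
qed

lemma pagerank_graph_base: "pagerank_graph base"
proof -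
  have "pair_fin_digraph base"
    using finite_S by unfold_locales (auto simp: base_def finite_Id_on dest: H.in_arcsD1 H.in_arcsD2)
  moreover have "parcs base `` {v} \<noteq> {}" if "v \<in> pverts base" for v
    using that pagerank_graph_out_nbrs(3)[OF pagerank_graph_H, of v] by (auto simp: base_def)
  ultimately show ?thesis
    by (simp add: pagerank_graph_def)
qed

lemma out_nbrs_base:
  "v \<in> pverts H \<Longrightarrow> parcs base `` {v} = parcs H `` {v}"
  "v \<in> insert hub S \<Longrightarrow> parcs base `` {v} = {v}"
  using reservoir_notin_H H.in_arcsD1 by (auto simp: base_def)

lemma in_nbrs_base: "v \<in> pverts H \<Longrightarrow> (parcs base)\<inverse> `` {v} = (parcs H)\<inverse> `` {v}"
  using reservoir_notin_H by (auto simp: base_def)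

lemma inj_on_redirect: "A \<subseteq> pverts H \<Longrightarrow> inj_on (redirect a b v) A"
  using reservoir_notin_H by (auto simp: redirect_def intro!: inj_on_fun_updI)

lemma out_nbrs_planted:
  assumes "(u, w) \<in> parcs H" "v \<in> pverts H"
  shows "parcs (planted u w) `` {v} = redirect u w v ` (parcs H `` {v})"
  using assms reservoir_notin_H by (auto simp: planted_def redirect_def image_iff)

lemma in_nbrs_planted:
  assumes "(u, w) \<in> parcs H" "v \<in> pverts H"
  shows "(parcs (planted u w))\<inverse> `` {v} = redirect w u v ` ((parcs H)\<inverse> `` {v})"
  using assms reservoir_notin_H by (auto simp: planted_def redirect_def image_iff)

lemma pagerank_graph_planted:
  assumes "(u, w) \<in> parcs H"
  shows "pagerank_graph (planted u w)"
proof -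
  have "pair_fin_digraph (planted u w)"
    using assms finite_S by unfold_locales (auto simp: planted_def dest: H.in_arcsD1 H.in_arcsD2)
  moreover have "parcs (planted u w) `` {v} \<noteq> {}" if "v \<in> pverts (planted u w)" for v
  proof (cases "v \<in> pverts H")
    case True
    then show ?thesis
      using out_nbrs_planted[OF assms] pagerank_graph_out_nbrs(3)[OF pagerank_graph_H] by simp
  next
    case False
    then have "v = hub \<or> v \<in> S"
      using that by (auto simp: planted_def)
    then show ?thesis
      by (auto simp: planted_def)
  qed
  ultimately show ?thesis
    by (simp add: pagerank_graph_def)
qed

lemma ppr_supersolution_base:
  assumes f: "ppr_supersolution \<alpha> H t f" and t: "t \<in> pverts H"
  shows "ppr_supersolution \<alpha> base t (\<lambda>v. if v \<in> pverts H then f v else 0)"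
    (is "ppr_supersolution _ _ _ ?g")
  unfolding ppr_supersolution_def
proof (intro conjI allI ballI)
  fix v assume "v \<in> pverts base"
  then consider (visible) "v \<in> pverts H" | (reservoir) "v \<in> insert hub S" "v \<notin> pverts H"
    by (auto simp: base_def)
  then show "\<alpha> * of_bool (v = t) + (1 - \<alpha>) * out_mean base ?g v \<le> ?g v"
  proof cases
    case visible
    have "(\<Sum>z\<in>parcs H `` {v}. ?g z) = (\<Sum>z\<in>parcs H `` {v}. f z)"
      using H.in_arcsD2 by (intro sum.cong) auto
    then have "out_mean base ?g v = out_mean H f v"
      using visible by (simp add: out_mean_def out_nbrs_base)
    then show ?thesis
      using visible f by (simp add: ppr_supersolution_def)
  next
    case reservoir
    then have "out_mean base ?g v = 0"
      by (simp add: out_mean_def out_nbrs_base)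
    then show ?thesis
      using reservoir t by auto
  qed
qed (use f in \<open>simp add: ppr_supersolution_def\<close>)

lemma pagerank_base_le:
  assumes \<alpha>: "0 \<le> \<alpha>" "\<alpha> \<le> 1" and "ppr_supersolution \<alpha> H t f" "t \<in> pverts H"
  shows "pagerank \<alpha> base t \<le> (\<Sum>v\<in>pverts H. f v) / real (card (pverts base))"
proof -
  let ?g = "\<lambda>v. if v \<in> pverts H then f v else 0"
  have "(\<Sum>s\<in>pverts base. ppr \<alpha> base s t) \<le> (\<Sum>s\<in>pverts base. ?g s)"
    using ppr_le_supersolution[OF pagerank_graph_base _ \<alpha> ppr_supersolution_base[OF assms(3,4)]]
    by (intro sum_mono)
  also have "\<dots> = (\<Sum>v\<in>pverts H. f v)"
    using pverts_H_subset_base finite_pverts_base by (simp add: sum.If_cases Int_absorb1)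
  finally show ?thesis
    unfolding pagerank_def by (simp add: divide_right_mono)
qed

lemma ppr_planted_ge:
  assumes \<alpha>: "0 \<le> \<alpha>" "\<alpha> \<le> 1" and arcs: "(u, w) \<in> parcs H" "(w, t) \<in> parcs H" "u \<noteq> w"
    and s: "s \<in> S"
  shows "(1 - \<alpha>) ^ 3 * \<alpha> / real (outdeg H w) \<le> ppr \<alpha> (planted u w) s t"
proof -
  have out: "parcs (planted u w) `` {s} = {hub}" "parcs (planted u w) `` {hub} = {w}"
    "parcs (planted u w) `` {w} = parcs H `` {w}"
    using s arcs reservoir_notin_H hub_notin_S H.in_arcsD1 by (auto simp: planted_def)
  have "finite (parcs (planted u w))"
    using finite_S by (simp add: planted_def)
  moreover have "successively (\<lambda>u' v. (u', v) \<in> parcs (planted u w)) ([s, hub, w] @ [t])"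
    using s arcs by (simp add: planted_def)
  ultimately show ?thesis
    using ppr_path_ge[OF \<alpha>, of "planted u w" "[s, hub, w]" t] by (simp add: out power3_eq_cube)
qed

lemma pagerank_planted_ge:
  assumes "0 \<le> \<alpha>" "\<alpha> \<le> 1" "(u, w) \<in> parcs H" "(w, t) \<in> parcs H" "u \<noteq> w"
  shows "real (card S) * ((1 - \<alpha>) ^ 3 * \<alpha> / real (outdeg H w)) / real (card (pverts base))
    \<le> pagerank \<alpha> (planted u w) t"
proof -
  have "real (card S) * ((1 - \<alpha>) ^ 3 * \<alpha> / real (outdeg H w))
      \<le> (\<Sum>s\<in>S. ppr \<alpha> (planted u w) s t)"
    using ppr_planted_ge[OF assms] by (intro sum_bounded_below)
  also have "\<dots> \<le> (\<Sum>s\<in>pverts base. ppr \<alpha> (planted u w) s t)"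
    using finite_pverts_base by (intro sum_mono2) (auto simp: base_def ppr_nonneg)
  finally show ?thesis
    unfolding pagerank_def pverts_planted by (rule divide_right_mono) simp
qed

definition planted_input :: "adj_lists \<Rightarrow> nat \<Rightarrow> nat \<Rightarrow> adj_lists" where
  "planted_input X u w = \<lparr>graph_of = planted u w,
     out_list = (\<lambda>v. if v \<in> pverts H then map (redirect u w v) (out_list X v)
       else sorted_list_of_set (parcs (planted u w) `` {v})),
     in_list = (\<lambda>v. if v \<in> pverts H then map (redirect w u v) (in_list X v)
       else sorted_list_of_set ((parcs (planted u w))\<inverse> `` {v}))\<rparr>"

context
  fixes X :: adj_lists
  assumes valid: "valid_input X" and graph: "graph_of X = base"
begin

lemma lists_base:
  assumes "v \<in> pverts H"
  shows "distinct (out_list X v)" "set (out_list X v) = parcs H `` {v}"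
    and "distinct (in_list X v)" "set (in_list X v) = (parcs H)\<inverse> `` {v}"
proof -
  have "v \<in> pverts base"
    using assms pverts_H_subset_base by blast
  then have "distinct (out_list X v) \<and> set (out_list X v) = parcs base `` {v} \<and>
      distinct (in_list X v) \<and> set (in_list X v) = (parcs base)\<inverse> `` {v}"
    using valid by (auto simp: valid_input_def graph)
  then show "distinct (out_list X v)" "set (out_list X v) = parcs H `` {v}"
    and "distinct (in_list X v)" "set (in_list X v) = (parcs H)\<inverse> `` {v}"
    using assms by (simp_all add: out_nbrs_base in_nbrs_base)
qed

lemma valid_planted_input:
  assumes uw: "(u, w) \<in> parcs H"
  shows "valid_input (planted_input X u w)"
proof -
  let ?Y = "planted_input X u w"
  have "distinct (out_list ?Y v) \<and> set (out_list ?Y v) = parcs (planted u w) `` {v} \<and>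
      distinct (in_list ?Y v) \<and> set (in_list ?Y v) = (parcs (planted u w))\<inverse> `` {v}" for v
  proof (cases "v \<in> pverts H")
    case True
    then have "set (out_list X v) \<subseteq> pverts H" "set (in_list X v) \<subseteq> pverts H"
      using lists_base[OF True] H.in_arcsD1 H.in_arcsD2 by auto
    then have "distinct (out_list ?Y v)" "distinct (in_list ?Y v)"
      using True lists_base[OF True] inj_on_redirect by (simp_all add: planted_input_def distinct_map)
    then show ?thesis
      using True lists_base[OF True] out_nbrs_planted[OF uw True] in_nbrs_planted[OF uw True]
      by (simp add: planted_input_def)
  next
    case False
    have "finite (parcs (planted u w))"
      using finite_S by (simp add: planted_def)
    then show ?thesis
      using False by (simp add: planted_input_def finite_Image)
  qed
  moreover have "graph_of ?Y = planted u w"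
    by (simp add: planted_input_def)
  ultimately show ?thesis
    using pagerank_graph_planted[OF uw] by (auto simp: valid_input_def)
qed

lemma query_closed_pverts_H: "query_closed X (pverts H)"
  unfolding query_closed_def
proof (intro allI impI)
  fix q v assume q: "query_nodes q \<subseteq> pverts H" "oracle_answer X q = Neighbor v"
  show "v \<in> pverts H"
  proof (cases q)
    case (IN z i)
    then have "v \<in> set (in_list X z)" "z \<in> pverts H"
      using q by (auto split: if_splits)
    then show ?thesis
      using lists_base(4) H.in_arcsD1 by auto
  next
    case (OUT z i)
    then have "v \<in> set (out_list X z)" "z \<in> pverts H"
      using q by (auto split: if_splits)
    then show ?thesis
      using lists_base(2) H.in_arcsD2 by auto
  qed (use q in auto)
qed

lemma agree_outside_planted_input:
  "agree_outside {q. probe X q = Some (u, w)} (pverts H) X (planted_input X u w)"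
proof -
  have "oracle_answer X q = oracle_answer (planted_input X u w) q"
    if "query_nodes q \<subseteq> pverts H" "probe X q \<noteq> Some (u, w)" for q
  proof (cases q)
    case (ADJ a b)
    then show ?thesis
      using that graph reservoir_notin_H by (auto simp: planted_input_def planted_def base_def)
  qed (use that in \<open>auto simp: planted_input_def redirect_def\<close>)
  then show ?thesis
    by (simp add: agree_outside_def graph pverts_planted planted_input_def)
qed

lemma expected_time_ge_card_arcs:
  assumes solves: "solves_single_node \<alpha> \<epsilon> p\<^sub>f A" and \<delta>: "\<delta> < 1 - 2 * p\<^sub>f"
    and t: "t \<in> pverts H" and E: "E \<subseteq> parcs H"
    and gap: "\<And>u w. (u, w) \<in> E \<Longrightarrow>
      (1 + \<epsilon>) * pagerank \<alpha> base t \<le> (1 - \<epsilon>) * pagerank \<alpha> (planted u w) t"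
  shows "ennreal (\<delta> * real (card E)) \<le> expected_time A X t"
proof (rule expected_time_ge_adversary[OF solves \<delta> valid _ t query_closed_pverts_H])
  have graph_planted: "graph_of (planted_input X u w) = planted u w" for u w
    by (simp add: planted_input_def)
  show "t \<in> pverts (graph_of X)"
    using t pverts_H_subset_base by (auto simp: graph)
  show "disjoint_family_on (\<lambda>e. {q. probe X q = Some e}) E"
    by (auto simp: disjoint_family_on_def)
  show "finite E"
    using E H.pair_finite_arcs by (rule finite_subset)
  show "valid_input (case_prod (planted_input X) e)"
    "t \<in> pverts (graph_of (case_prod (planted_input X) e))"
    "agree_outside {q. probe X q = Some e} (pverts H) X (case_prod (planted_input X) e)"
    "(1 + \<epsilon>) * pagerank \<alpha> (graph_of X) t
      \<le> (1 - \<epsilon>) * pagerank \<alpha> (graph_of (case_prod (planted_input X) e)) t"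
    if "e \<in> E" for e
    using that E t pverts_H_subset_base valid_planted_input agree_outside_planted_input gap
    by (auto simp: graph graph_planted pverts_planted split: prod.split)
qed

end

end


section \<open>The hard instance\<close>

definition layered :: "nat set \<Rightarrow> nat set \<Rightarrow> nat set \<Rightarrow> nat pair_pre_digraph" where
  "layered U W T = \<lparr>pverts = U \<union> W \<union> T, parcs = U \<times> W \<union> W \<times> T \<union> Id_on T\<rparr>"

lemma layered_sel:
  "pverts (layered U W T) = U \<union> W \<union> T"
  "parcs (layered U W T) = U \<times> W \<union> W \<times> T \<union> Id_on T"
  by (simp_all add: layered_def)

locale layers =
  fixes U W T :: "nat set"
  assumes finite_layers: "finite U" "finite W" "finite T"
    and nonempty: "W \<noteq> {}" "T \<noteq> {}"
    and disjoint_layers: "U \<inter> W = {}" "U \<inter> T = {}" "W \<inter> T = {}"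
begin

lemma out_nbrs_layered:
  "v \<in> U \<Longrightarrow> parcs (layered U W T) `` {v} = W"
  "v \<in> W \<Longrightarrow> parcs (layered U W T) `` {v} = T"
  "v \<in> T \<Longrightarrow> parcs (layered U W T) `` {v} = {v}"
  using disjoint_layers by (auto simp: layered_sel)

lemma pagerank_graph_layered: "pagerank_graph (layered U W T)"
proof -
  have "pair_fin_digraph (layered U W T)"
    using finite_layers by unfold_locales (auto simp: layered_sel finite_Id_on)
  moreover have "parcs (layered U W T) `` {v} \<noteq> {}" if "v \<in> pverts (layered U W T)" for v
    using that nonempty by (auto simp: layered_sel)
  ultimately show ?thesis
    by (simp add: pagerank_graph_def)
qed

lemma card_pverts_layered: "card (pverts (layered U W T)) = card U + card W + card T"
  using finite_layers disjoint_layers by (simp add: layered_sel card_Un_disjoint Int_Un_distrib2)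

lemma card_parcs_layered: "card (parcs (layered U W T)) = card U * card W + card W * card T + card T"
proof -
  have "U \<times> W \<inter> W \<times> T = {}" "(U \<times> W \<union> W \<times> T) \<inter> Id_on T = {}"
    using disjoint_layers by auto
  then show ?thesis
    using finite_layers
    by (simp add: layered_sel card_Un_disjoint card_cartesian_product card_Id_on finite_Id_on)
qed

definition layered_ppr_bound :: "nat \<Rightarrow> nat \<Rightarrow> real" where
  "layered_ppr_bound t v = of_bool (v = t) + of_bool (v \<in> U \<union> W) / real (card T)"

lemma out_mean_layered_ppr_bound:
  assumes t: "t \<in> T" and v: "v \<in> U \<union> W"
  shows "out_mean (layered U W T) (layered_ppr_bound t) v = 1 / real (card T)"
  using v
proof
  assume "v \<in> U"
  have "(\<Sum>z\<in>W. layered_ppr_bound t z) = (\<Sum>z\<in>W. 1 / real (card T))"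
    using t disjoint_layers by (intro sum.cong) (auto simp: layered_ppr_bound_def)
  then show ?thesis
    using \<open>v \<in> U\<close> finite_layers nonempty by (simp add: out_mean_def out_nbrs_layered)
next
  assume "v \<in> W"
  have "(\<Sum>z\<in>T. layered_ppr_bound t z) = (\<Sum>z\<in>T. if z = t then 1 else 0)"
    using disjoint_layers by (intro sum.cong) (auto simp: layered_ppr_bound_def)
  then show ?thesis
    using \<open>v \<in> W\<close> t finite_layers by (simp add: out_mean_def out_nbrs_layered)
qed

lemma ppr_supersolution_layered:
  assumes \<alpha>: "0 \<le> \<alpha>" "\<alpha> \<le> 1" and t: "t \<in> T"
  shows "ppr_supersolution \<alpha> (layered U W T) t (layered_ppr_bound t)"
  unfolding ppr_supersolution_def
proof (intro conjI allI ballI)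
  fix v assume "v \<in> pverts (layered U W T)"
  then consider "v \<in> U \<union> W" | "v \<in> T"
    by (auto simp: layered_sel)
  then show "\<alpha> * of_bool (v = t) + (1 - \<alpha>) * out_mean (layered U W T) (layered_ppr_bound t) v
      \<le> layered_ppr_bound t v"
  proof cases
    assume v: "v \<in> U \<union> W"
    then have "v \<noteq> t" "layered_ppr_bound t v = 1 / real (card T)"
      using t disjoint_layers by (auto simp: layered_ppr_bound_def)
    then show ?thesis
      using out_mean_layered_ppr_bound[OF t v] \<alpha> by (simp add: divide_right_mono)
  next
    assume "v \<in> T"
    then have "out_mean (layered U W T) (layered_ppr_bound t) v = layered_ppr_bound t v"
      "layered_ppr_bound t v = of_bool (v = t)"
      using disjoint_layers by (auto simp: out_mean_def out_nbrs_layered layered_ppr_bound_def)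
    then show ?thesis
      by simp
  qed
qed (simp add: layered_ppr_bound_def)

lemma sum_layered_ppr_bound:
  assumes "t \<in> T"
  shows "(\<Sum>v\<in>pverts (layered U W T). layered_ppr_bound t v) =
    1 + real (card U + card W) / real (card T)"
proof -
  let ?V = "U \<union> W \<union> T"
  have "(\<Sum>v\<in>?V. of_bool (v = t) :: real) = 1"
    using assms finite_layers by (simp add: of_bool_def)
  moreover have "(\<Sum>v\<in>?V. of_bool (v \<in> U \<union> W) :: real) = real (card (?V \<inter> {v. v \<in> U \<union> W}))"
    using finite_layers by (subst sum_of_bool_eq) auto
  moreover have "?V \<inter> {v. v \<in> U \<union> W} = U \<union> W"
    by auto
  ultimately show ?thesis
    using finite_layers disjoint_layers
    by (simp add: layered_ppr_bound_def layered_sel sum.distrib sum_divide_distrib[symmetric]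
        card_Un_disjoint)
qed

end

locale hard_instance =
  fixes n m N :: nat
  assumes size_bounds: "1 \<le> n" "n \<le> m" "m \<le> n\<^sup>2"
begin

abbreviation k :: nat where "k \<equiv> m div n"

lemma k_bounds: "1 \<le> k" "k \<le> n"
  using size_bounds div_le_mono[of m "n * n" n]
  by (simp_all add: div_greater_zero_iff Suc_le_eq power2_eq_square)

lemma n_times_k_bounds: "n * k \<le> m" "m \<le> 2 * (n * k)"
proof -
  show "n * k \<le> m"
    by simp
  have "m = n * k + m mod n" "m mod n < n"
    using size_bounds by simp_all
  moreover have "n \<le> n * k"
    using k_bounds by simp
  ultimately show "m \<le> 2 * (n * k)"
    by linarith
qed

definition U :: "nat set" where "U = {0..<n}"
definition W :: "nat set" where "W = {n..<n + k}"
definition T :: "nat set" where "T = {n + k..<2 * n + k}"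
definition S :: "nat set" where "S = {2 * n + k..<2 * n + k + N * n}"
definition hub :: nat where "hub = 2 * n + k + N * n"

lemma card_parts: "card U = n" "card W = k" "card T = n" "card S = N * n"
  by (simp_all add: U_def W_def T_def S_def)

sublocale layers U W T
  using size_bounds k_bounds by unfold_locales (auto simp: U_def W_def T_def)

sublocale reservoir "layered U W T" S hub
  using pagerank_graph_layered
  by unfold_locales (auto simp: layered_sel U_def W_def T_def S_def hub_def)

lemma card_pverts_bounds:
  "real n \<le> real (card (pverts base))" "real (card (pverts base)) \<le> (real N + 4) * real n"
proof -
  have verts: "card (pverts base) = 2 * n + k + N * n + 1"
    by (simp add: card_pverts_base card_pverts_layered card_parts)
  then show "real n \<le> real (card (pverts base))"
    by simp
  have "card (pverts base) \<le> (N + 4) * n"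
    using size_bounds k_bounds by (simp add: verts algebra_simps)
  from of_nat_mono[OF this, where 'a = real] show "real (card (pverts base)) \<le> (real N + 4) * real n"
    by simp
qed

lemma card_parcs_bounds:
  "real m \<le> 2 * real (card (parcs base))" "real (card (parcs base)) \<le> (real N + 4) * real m"
proof -
  have arcs: "card (parcs base) = 2 * (n * k) + n + N * n + 1"
    by (simp add: card_parcs_base card_parcs_layered card_parts)
  then show "real m \<le> 2 * real (card (parcs base))"
    using n_times_k_bounds(2) by linarith
  have "card (parcs base) \<le> 2 * m + m + N * m + m"
    unfolding arcs using size_bounds n_times_k_bounds(1) by (intro add_mono mult_le_mono) auto
  then have "card (parcs base) \<le> (N + 4) * m"
    by (simp add: algebra_simps)
  from of_nat_mono[OF this, where 'a = real] show "real (card (parcs base)) \<le> (real N + 4) * real m"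
    by simp
qed

context
  fixes \<alpha> \<epsilon> :: real
  assumes \<alpha>: "0 \<le> \<alpha>" "\<alpha> \<le> 1" and \<epsilon>: "0 \<le> \<epsilon>" "\<epsilon> \<le> 1"
    and large: "(1 + \<epsilon>) * 3 \<le> (1 - \<epsilon>) * (real N * ((1 - \<alpha>) ^ 3 * \<alpha>))"
begin

lemma pagerank_gap:
  assumes uw: "u \<in> U" "w \<in> W" and t: "t \<in> T"
  shows "(1 + \<epsilon>) * pagerank \<alpha> base t \<le> (1 - \<epsilon>) * pagerank \<alpha> (planted u w) t"
proof -
  let ?V = "real (card (pverts base))"
  have "u \<noteq> w"
    using uw disjoint_layers by auto
  have "pagerank \<alpha> base t \<le> (1 + real (card U + card W) / real (card T)) / ?V"
    using pagerank_base_le[OF \<alpha> ppr_supersolution_layered[OF \<alpha> t]] t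
    unfolding sum_layered_ppr_bound[OF t] by (simp add: layered_sel)
  also have "\<dots> \<le> 3 / ?V"
    using size_bounds k_bounds by (intro divide_right_mono) (simp_all add: card_parts field_simps)
  finally have "(1 + \<epsilon>) * pagerank \<alpha> base t \<le> (1 + \<epsilon>) * (3 / ?V)"
    using \<epsilon> by (intro mult_left_mono) auto
  also have "\<dots> \<le> (1 - \<epsilon>) * (real N * ((1 - \<alpha>) ^ 3 * \<alpha>) / ?V)"
    using divide_right_mono[OF large, of ?V] by simp
  also have "real N * ((1 - \<alpha>) ^ 3 * \<alpha>) = real (card S) * ((1 - \<alpha>) ^ 3 * \<alpha> / real (card T))"
    using size_bounds by (simp add: card_parts)
  also have "(1 - \<epsilon>) * (\<dots> / ?V) \<le> (1 - \<epsilon>) * pagerank \<alpha> (planted u w) t"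
    using pagerank_planted_ge[OF \<alpha>, of u w t] \<open>u \<noteq> w\<close> uw t \<epsilon> out_nbrs_layered(2)[OF uw(2)]
    by (intro mult_left_mono) (auto simp: layered_sel)
  finally show ?thesis .
qed

context
  fixes p\<^sub>f \<delta> :: real and X :: adj_lists and A :: algorithm
  assumes \<delta>: "0 \<le> \<delta>" "\<delta> < 1 - 2 * p\<^sub>f"
    and input: "valid_input X" "graph_of X = base" and solves: "solves_single_node \<alpha> \<epsilon> p\<^sub>f A"
begin

lemma expected_time_ge:
  assumes t: "t \<in> T"
  shows "ennreal (\<delta> / 2 * real m) \<le> expected_time A X t"
proof -
  have "\<delta> / 2 * real m \<le> \<delta> / 2 * real (2 * (n * k))"
    using n_times_k_bounds(2) \<delta> by (intro mult_left_mono) (auto simp only: of_nat_le_iff)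
  then have "ennreal (\<delta> / 2 * real m) \<le> ennreal (\<delta> * real (card (U \<times> W)))"
    by (intro ennreal_leI) (simp add: card_cartesian_product card_parts)
  also have "\<dots> \<le> expected_time A X t"
    using t pagerank_gap[OF _ _ t]
    by (intro expected_time_ge_card_arcs[OF input solves \<delta>(2)]) (auto simp: layered_sel)
  finally show ?thesis .
qed

lemma mean_expected_time_ge:
  "ennreal (\<delta> / (2 * (real N + 4)) * real m)
    \<le> (\<Sum>t\<in>pverts base. expected_time A X t) / of_nat (card (pverts base))"
proof -
  have "T \<subseteq> pverts base" "pverts base \<noteq> {}"
    using pverts_H_subset_base nonempty by (auto simp: layered_sel)
  moreover have "real (card (pverts base)) \<le> (real N + 4) * real (card T)"
    using card_pverts_bounds(2) by (simp add: card_parts)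
  ultimately have "ennreal (\<delta> / 2 * real m / (real N + 4))
      \<le> (\<Sum>t\<in>pverts base. expected_time A X t) / of_nat (card (pverts base))"
    using expected_time_ge \<delta> finite_pverts_base by (intro mean_ge_if_ge_on_subset[where T = T]) auto
  then show ?thesis
    by simp
qed

lemma ex_expected_time_ge:
  "\<exists>t\<in>pverts base. ennreal (\<delta> / (2 * (real N + 4)) * real m) \<le> expected_time A X t"
proof -
  have "pverts base \<noteq> {}"
    by (simp add: base_def)
  then show ?thesis
    using ex_ge_mean[OF finite_pverts_base] mean_expected_time_ge order_trans by blast
qed

end

end

end

theorem theorem6p5:
  fixes \<alpha> \<epsilon> p\<^sub>f :: real
  assumes "0 < \<alpha>" "\<alpha> < 1"
    and "0 < \<epsilon>" "\<epsilon> < 1"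
    and "0 < p\<^sub>f" "p\<^sub>f < 1 / 2"
  shows "\<exists>c>0. \<exists>C>0. \<exists>d>0. \<forall>n m :: nat. 1 \<le> n \<and> n \<le> m \<and> m \<le> n\<^sup>2 \<longrightarrow>
    (\<exists>G. pagerank_graph G \<and>
       c * real n \<le> real (card (pverts G)) \<and> real (card (pverts G)) \<le> C * real n \<and>
       c * real m \<le> real (card (parcs G)) \<and> real (card (parcs G)) \<le> C * real m \<and>
       (\<forall>X A. valid_input X \<and> graph_of X = G \<and> solves_single_node \<alpha> \<epsilon> p\<^sub>f A \<longrightarrow>
          (\<Sum>t\<in>pverts G. expected_time A X t) / of_nat (card (pverts G)) \<ge> ennreal (d * real m) \<and>
          (\<exists>t\<in>pverts G. expected_time A X t \<ge> ennreal (d * real m))))"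
    (is "\<exists>c>0. \<exists>C>0. \<exists>d>0. \<forall>n m. ?range n m \<longrightarrow> (\<exists>G. ?hard c C d n m G)")
proof -
  have "0 < (1 - \<epsilon>) * ((1 - \<alpha>) ^ 3 * \<alpha>)"
    using assms by simp
  then obtain N :: nat where "(1 + \<epsilon>) * 3 < real N * ((1 - \<epsilon>) * ((1 - \<alpha>) ^ 3 * \<alpha>))"
    using ex_less_of_nat_mult by blast
  then have large: "(1 + \<epsilon>) * 3 \<le> (1 - \<epsilon>) * (real N * ((1 - \<alpha>) ^ 3 * \<alpha>))"
    by (simp add: mult.left_commute)
  define \<delta> where "\<delta> = (1 - 2 * p\<^sub>f) / 2"
  have \<delta>: "0 < \<delta>" "\<delta> < 1 - 2 * p\<^sub>f"
    using assms by (simp_all add: \<delta>_def)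
  have "\<exists>G. ?hard (1 / 2) (real N + 4) (\<delta> / (2 * (real N + 4))) n m G" if "?range n m" for n m
  proof -
    interpret hard_instance n m N
      using that by unfold_locales auto
    show ?thesis
      using assms \<delta> large pagerank_graph_base card_pverts_bounds card_parcs_bounds
      by (intro exI[of _ base] conjI allI impI mean_expected_time_ge ex_expected_time_ge) auto
  qed
  then show ?thesis
    using \<delta>(1)
    by (intro exI[of _ "1 / 2"] exI[of _ "real N + 4"] exI[of _ "\<delta> / (2 * (real N + 4))"] conjI) auto
qed

end
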